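(* Let $N,M\in\mathbb{N}$ and $\mathcal{S}_{N,M}=\{x\in\mathbb{Z}^N:\|x\|_1\le M\}$. Suppose $W\ge2$, $L\ge1$ are integers such that for every $(x_1,\dots,x_N)^\top\in\mathcal{S}_{N,M}$ there exists $g\in\mathcal{NN}_{1,1}(W,L)$ with $g(n)=x_n$ for $n=1,\dots,N$. (1) If $N\ge M\ge C_0N^{1/p}$ for some $p\ge1$ and constant $C_0>0$, then $W^2L^2\log(WL)\ge C_p\,M(1+\log(N/M))$ for a constant $C_p>0$ depending only on $p$ and $C_0$. (2) If $N\le M\le C_0N^{p}$ for some $p\ge1$ and constant $C_0>0$, then $W^2L^2\log(WL)\ge C_p\,N(1+\log(M/N))$ for a constant $C_p>0$ depending only on $p$ and $C_0$.
   Context: $\mathcal{NN}_{d,k}(W,L)$: set of maps $g:\mathbb{R}^d\to\mathbb{R}^k$ given by $g_0(x)=x$, $g_{\ell+1}(x)=\sigma(A_\ell g_\ell(x)+b_\ell)$ ($\ell=0,\dots,L-1$), $g(x)=A_Lg_L(x)+b_L$, with $A_\ell\in\mathbb{R}^{N_{\ell+1}\times N_\ell}$, $b_\ell\in\mathbb{R}^{N_{\ell+1}}$, $N_0=d$, $N_{L+1}=k$, $\max\{N_1,\dots,N_L\}\le W$, $\sigma(t)=\max\{t,0\}$ componentwise. *)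

theory Defs
  imports Complex_Main
begin

text \<open>ReLU networks. Vectors in R^n are represented as functions nat \<Rightarrow> real, of which
only the coordinates 0..n-1 are relevant (the others are set to 0 in outputs).
A network of depth L is given by widths Ns 0, ..., Ns (L+1), weight matrices
A l (of size Ns (l+1) x Ns l, entries A l i j) and biases b l (l = 0..L).\<close>

fun layer_out :: "(nat \<Rightarrow> nat \<Rightarrow> nat \<Rightarrow> real) \<Rightarrow> (nat \<Rightarrow> nat \<Rightarrow> real) \<Rightarrow> (nat \<Rightarrow> nat)
    \<Rightarrow> nat \<Rightarrow> (nat \<Rightarrow> real) \<Rightarrow> (nat \<Rightarrow> real)" where
  "layer_out A b Ns 0 x = (\<lambda>j. if j < Ns 0 then x j else 0)"
| "layer_out A b Ns (Suc l) x =
     (\<lambda>i. if i < Ns (Suc l)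
          then max 0 ((\<Sum>j<Ns l. A l i j * layer_out A b Ns l x j) + b l i) else 0)"

definition nn_eval :: "(nat \<Rightarrow> nat \<Rightarrow> nat \<Rightarrow> real) \<Rightarrow> (nat \<Rightarrow> nat \<Rightarrow> real) \<Rightarrow> (nat \<Rightarrow> nat)
    \<Rightarrow> nat \<Rightarrow> (nat \<Rightarrow> real) \<Rightarrow> (nat \<Rightarrow> real)" where
  "nn_eval A b Ns L x =
     (\<lambda>i. if i < Ns (Suc L)
          then (\<Sum>j<Ns L. A L i j * layer_out A b Ns L x j) + b L i else 0)"

definition NN :: "nat \<Rightarrow> nat \<Rightarrow> nat \<Rightarrow> nat \<Rightarrow> ((nat \<Rightarrow> real) \<Rightarrow> (nat \<Rightarrow> real)) set" where
  "NN d k W L = {g. \<exists>A b Ns. Ns 0 = d \<and> Ns (Suc L) = k \<and> (\<forall>l\<in>{1..L}. Ns l \<le> W)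
                         \<and> g = nn_eval A b Ns L}"

definition S_set :: "nat \<Rightarrow> nat \<Rightarrow> (nat \<Rightarrow> int) set" where
  "S_set N M = {x. (\<Sum>n\<in>{1..N}. \<bar>x n\<bar>) \<le> int M}"

definition interpolates_all :: "nat \<Rightarrow> nat \<Rightarrow> nat \<Rightarrow> nat \<Rightarrow> bool" where
  "interpolates_all N M W L \<longleftrightarrow>
     (\<forall>x\<in>S_set N M. \<exists>g\<in>NN 1 1 W L. \<forall>n\<in>{1..N}. g (\<lambda>_. real n) 0 = real_of_int (x n))"

end

(* For integer-valued targets the whole interpolating sequence can be read off the signs
of g(n) - k for integers |k| <= M, so it suffices to bound the number of sign patterns that the
P ~ W^2 L parameters can produce. Once the activation pattern of the layers below l is fixed, the
preactivations of layer l are polynomials of degree at most l + 1 in the parameters; hence the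
patterns multiply by a polynomial-sign-pattern count at each layer, giving (N M W L)^{O(P L)} in all.
The weak form of Warren's theorem needed here (at most (2D+1)^P sign patterns, D the total degree)
is proved without algebraic geometry: for small e > 0 every cell contains a local maximum of
F^2 - e * (sum of x_i^(2D+2)), F the product of the polynomials, and at critical points each
x_i^(2D+1) equals a polynomial of lower degree, so there are at most (2D+1)^P of them.
Since the larger of N and M is polynomial in the smaller, which the estimate itself bounds, log N
and log M are finally O(log (W L)). *)

theory Submission
  imports Defs "HOL-Analysis.Function_Topology"
begin

section \<open>Polynomial functions and systems of polynomial equations\<close>

text \<open>Polynomials are kept as functions, with \<open>d\<close> only an upper bound for the
  degree. Continuity, partial derivatives, growth and reduction to monomials then all follow by rule
  induction.\<close>

inductive polyfun :: "'i set \<Rightarrow> nat \<Rightarrow> (('i \<Rightarrow> real) \<Rightarrow> real) \<Rightarrow> bool" for I where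
  const: "polyfun I d (\<lambda>x. c)"
| var: "i \<in> I \<Longrightarrow> polyfun I 1 (\<lambda>x. x i)"
| add: "polyfun I d f \<Longrightarrow> polyfun I d g \<Longrightarrow> polyfun I d (\<lambda>x. f x + g x)"
| mult: "polyfun I d f \<Longrightarrow> polyfun I e g \<Longrightarrow> polyfun I (d + e) (\<lambda>x. f x * g x)"
| mono: "polyfun I d f \<Longrightarrow> d \<le> e \<Longrightarrow> polyfun I e f"

lemma polyfun_cmult: "polyfun I d f \<Longrightarrow> polyfun I d (\<lambda>x. c * f x)"
  using polyfun.mult[OF polyfun.const[of I 0 c], of d f] by simp

lemma polyfun_sum:
  "(\<And>j. j \<in> J \<Longrightarrow> polyfun I d (f j)) \<Longrightarrow> polyfun I d (\<lambda>x. \<Sum>j\<in>J. f j x)"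
  by (induction J rule: infinite_finite_induct) (auto intro: polyfun.const polyfun.add)

lemma polyfun_prod:
  "(\<And>j. j \<in> J \<Longrightarrow> polyfun I (d j) (f j)) \<Longrightarrow> polyfun I (\<Sum>j\<in>J. d j) (\<lambda>x. \<Prod>j\<in>J. f j x)"
  by (induction J rule: infinite_finite_induct) (auto intro: polyfun.const polyfun.mult)

lemma polyfun_power: "polyfun I d f \<Longrightarrow> polyfun I (k * d) (\<lambda>x. f x ^ k)"
  by (induction k) (auto intro: polyfun.const polyfun.mult)

lemma polyfun_continuous: "polyfun I d f \<Longrightarrow> continuous_on UNIV f"
  by (induction rule: polyfun.induct) (auto intro!: continuous_intros)

text \<open>The degree bound is kept rather than lowered by one: the critical equations compare
  degree 2D with the power 2D + 1, so this suffices.\<close>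

lemma polyfun_partial_derivative:
  assumes "polyfun I d f"
  shows "\<exists>f'. polyfun I d f' \<and>
    (\<forall>x. ((\<lambda>t. f (x(i := t))) has_real_derivative f' x) (at (x i)))"
  using assms
proof (induction rule: polyfun.induct)
  case (const d c)
  show ?case by (intro exI[of _ "\<lambda>x. 0"]) (auto intro: polyfun.const)
next
  case (var j)
  show ?case
    by (intro exI[of _ "\<lambda>x. if j = i then 1 else 0"]) (auto intro: polyfun.const)
next
  case (add d f g)
  then obtain f' g' where D:
    "polyfun I d f'" "\<And>x. ((\<lambda>t. f (x(i := t))) has_real_derivative f' x) (at (x i))"
    "polyfun I d g'" "\<And>x. ((\<lambda>t. g (x(i := t))) has_real_derivative g' x) (at (x i))"
    by blast
  have D': "((\<lambda>t. f (x(i := t)) + g (x(i := t))) has_real_derivative f' x + g' x) (at (x i))" for x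
    using DERIV_add[OF D(2)[of x] D(4)[of x]] .
  show ?case
    by (intro exI[of _ "\<lambda>x. f' x + g' x"] conjI allI polyfun.add D D')
next
  case (mult d f e g)
  then obtain f' g' where D:
    "polyfun I d f'" "\<And>x. ((\<lambda>t. f (x(i := t))) has_real_derivative f' x) (at (x i))"
    "polyfun I e g'" "\<And>x. ((\<lambda>t. g (x(i := t))) has_real_derivative g' x) (at (x i))"
    by blast
  have D': "((\<lambda>t. f (x(i := t)) * g (x(i := t))) has_real_derivative f' x * g x + f x * g' x) (at (x i))"
    for x
    using DERIV_mult[OF D(2)[of x] D(4)[of x]] by (simp add: algebra_simps)
  show ?case
    by (intro exI[of _ "\<lambda>x. f' x * g x + f x * g' x"] conjI allI polyfun.add polyfun.mult
        D mult.hyps D')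
next
  case (mono d f e)
  then show ?case by (meson polyfun.mono)
qed

text \<open>Serves to show that the penalty of degree 2D + 2 wins at infinity. With \<open>m\<close>
  at least 1, \<open>m ^ d\<close> absorbs all lower powers.\<close>

lemma polyfun_growth:
  assumes "polyfun I d f"
  shows "\<exists>C. \<forall>m x. 1 \<le> m \<longrightarrow> (\<forall>i\<in>I. \<bar>x i\<bar> \<le> m) \<longrightarrow> \<bar>f x\<bar> \<le> C * m ^ d"
  using assms
proof (induction rule: polyfun.induct)
  case (const d c)
  have "\<bar>c\<bar> \<le> \<bar>c\<bar> * m ^ d" if "1 \<le> m" for m :: real
    using that by (simp add: mult_left_le one_le_power mult_le_cancel_left1)
  then show ?case by blast
next
  case (var i)
  then show ?case by (intro exI[of _ 1]) auto
next
  case (add d f g)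
  then obtain C C' where C:
    "\<And>m x. 1 \<le> m \<Longrightarrow> (\<forall>i\<in>I. \<bar>x i\<bar> \<le> m) \<Longrightarrow> \<bar>f x\<bar> \<le> C * m ^ d"
    "\<And>m x. 1 \<le> m \<Longrightarrow> (\<forall>i\<in>I. \<bar>x i\<bar> \<le> m) \<Longrightarrow> \<bar>g x\<bar> \<le> C' * m ^ d"
    by metis
  have "\<bar>f x + g x\<bar> \<le> (C + C') * m ^ d" if "1 \<le> m" "\<forall>i\<in>I. \<bar>x i\<bar> \<le> m" for m x
    using C(1)[OF that] C(2)[OF that] by (simp add: algebra_simps)
  then show ?case by blast
next
  case (mult d f e g)
  then obtain C C' where C:
    "\<And>m x. 1 \<le> m \<Longrightarrow> (\<forall>i\<in>I. \<bar>x i\<bar> \<le> m) \<Longrightarrow> \<bar>f x\<bar> \<le> C * m ^ d"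
    "\<And>m x. 1 \<le> m \<Longrightarrow> (\<forall>i\<in>I. \<bar>x i\<bar> \<le> m) \<Longrightarrow> \<bar>g x\<bar> \<le> C' * m ^ e"
    by metis
  have "\<bar>f x * g x\<bar> \<le> (C * C') * m ^ (d + e)" if "1 \<le> m" "\<forall>i\<in>I. \<bar>x i\<bar> \<le> m" for m x
  proof -
    have "\<bar>f x\<bar> * \<bar>g x\<bar> \<le> (C * m ^ d) * (C' * m ^ e)"
      using C(1)[OF that] C(2)[OF that] by (intro mult_mono) (auto intro: order_trans[OF abs_ge_zero])
    then show ?thesis by (simp add: abs_mult power_add algebra_simps)
  qed
  then show ?case by blast
next
  case (mono d f e)
  then obtain C where C: "\<And>m x. 1 \<le> m \<Longrightarrow> (\<forall>i\<in>I. \<bar>x i\<bar> \<le> m) \<Longrightarrow> \<bar>f x\<bar> \<le> C * m ^ d"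
    by metis
  have "\<bar>f x\<bar> \<le> \<bar>C\<bar> * m ^ e" if "1 \<le> m" "\<forall>i\<in>I. \<bar>x i\<bar> \<le> m" for m x
  proof -
    have "\<bar>f x\<bar> \<le> C * m ^ d" by (rule C[OF that])
    also have "\<dots> \<le> \<bar>C\<bar> * m ^ e"
      using that(1) mono.hyps by (intro mult_mono power_increasing) auto
    finally show ?thesis .
  qed
  then show ?case by blast
qed

definition monomial :: "'i set \<Rightarrow> ('i \<Rightarrow> nat) \<Rightarrow> ('i \<Rightarrow> real) \<Rightarrow> real" where
  "monomial I a x = (\<Prod>i\<in>I. x i ^ a i)"

lemma polyfun_monomial: "polyfun I (sum a I) (monomial I a)"
  unfolding monomial_def using polyfun_power[OF polyfun.var, of _ I] 
  by (intro polyfun_prod) (metis mult.right_neutral)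

lemma monomial_mult: "monomial I a x * monomial I b x = monomial I (\<lambda>i. a i + b i) x"
  by (simp add: monomial_def prod.distrib power_add)

text \<open>Stating the expansion into monomials dually, with the weights quantified, makes the product
  case a mere change of weights.\<close>

lemma polyfun_annihilated:
  assumes "polyfun I d f" and "finite I"
    and "\<And>a. sum a I \<le> d \<Longrightarrow> (\<Sum>z\<in>Z. c z * monomial I a z) = 0"
  shows "(\<Sum>z\<in>Z. c z * f z) = 0"
  using assms(1,3)
proof (induction arbitrary: c rule: polyfun.induct)
  case (const d k)
  show ?case using const[of "\<lambda>_. 0"]
    by (simp add: monomial_def flip: sum_distrib_right)
next
  case (var i)
  have "monomial I (\<lambda>j. if j = i then 1 else 0) z = z i" for z
    using var(1) \<open>finite I\<close> by (simp add: monomial_def if_distrib cong: if_cong)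
  then show ?case using var(2)[of "\<lambda>j. if j = i then 1 else 0"] var(1) \<open>finite I\<close> by simp
next
  case (add d f g)
  then show ?case by (simp add: distrib_left sum.distrib)
next
  case (mult d f e g)
  have "(\<Sum>z\<in>Z. (c z * g z) * f z) = 0"
  proof (rule mult.IH(1))
    fix a assume a: "sum a I \<le> d"
    have "(\<Sum>z\<in>Z. (c z * monomial I a z) * g z) = 0"
    proof (rule mult.IH(2))
      fix b assume "sum b I \<le> e"
      then show "(\<Sum>z\<in>Z. (c z * monomial I a z) * monomial I b z) = 0"
        using mult.prems[of "\<lambda>i. a i + b i"] a by (simp add: mult.assoc monomial_mult sum.distrib)
    qed
    then show "(\<Sum>z\<in>Z. (c z * g z) * monomial I a z) = 0" by (simp add: mult_ac)
  qed
  then show ?case by (simp add: mult_ac)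
next
  case (mono d f e)
  then show ?case by simp
qed

text \<open>Gaussian elimination: equation \<open>k\<close> is solved for the unknown at some
  \<open>w\<close> with \<open>b k w \<noteq> 0\<close>, leaving one equation and one unknown
  less.\<close>

lemma homogeneous_system_nontrivial:
  fixes b :: "'k \<Rightarrow> 'a \<Rightarrow> real"
  assumes "finite K" "finite Z" "card K < card Z"
  shows "\<exists>c. (\<exists>z\<in>Z. c z \<noteq> 0) \<and> (\<forall>k\<in>K. (\<Sum>z\<in>Z. c z * b k z) = 0)"
  using assms
proof (induction K arbitrary: b Z rule: finite_induct)
  case empty
  then have "Z \<noteq> {}" by auto
  then show ?case by (intro exI[of _ "\<lambda>_. 1"]) auto
next
  case (insert k K)
  show ?case
  proof (cases "\<forall>z\<in>Z. b k z = 0")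
    case True
    then show ?thesis using insert.IH[of Z b] insert.prems insert.hyps by auto
  next
    case False
    then obtain w where w: "w \<in> Z" "b k w \<noteq> 0" by blast
    \<comment> \<open>Coefficients of the other equations after the unknown at \<open>w\<close> has
      been substituted.\<close>
    define \<phi> where "\<phi> l z = b l z - b l w / b k w * b k z" for l z
    have "card K < card (Z - {w})" using insert.prems insert.hyps w by simp
    then obtain c where c: "\<exists>z\<in>Z - {w}. c z \<noteq> 0"
        "\<And>l. l \<in> K \<Longrightarrow> (\<Sum>z\<in>Z - {w}. c z * \<phi> l z) = 0"
      using insert.IH[of "Z - {w}" \<phi>] insert.prems by auto
    define s where "s = (\<Sum>z\<in>Z - {w}. c z * b k z)"
    \<comment> \<open>The value at \<open>w\<close> is the one that equation \<open>k\<close>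
      forces.\<close>
    define c' where "c' = c(w := - s / b k w)"
    have split: "(\<Sum>z\<in>Z. c' z * b l z) = - s / b k w * b l w + (\<Sum>z\<in>Z - {w}. c z * b l z)" for l
      using insert.prems(1) w(1) by (simp add: c'_def sum.remove[of Z w])
    have "(\<Sum>z\<in>Z - {w}. c z * b l z) = b l w / b k w * s" if "l \<in> K" for l
      using c(2)[OF that]
      by (simp add: \<phi>_def s_def right_diff_distrib sum_subtractf sum_distrib_left mult_ac)
    then have "\<forall>l\<in>insert k K. (\<Sum>z\<in>Z. c' z * b l z) = 0"
      using w(2) by (auto simp: split s_def[symmetric])
    moreover have "\<exists>z\<in>Z. c' z \<noteq> 0" using c(1) by (auto simp: c'_def)
    ultimately show ?thesis by blast
  qed
qed

text \<open>Each other point \<open>w\<close> contributes a factor, affine in one coordinate of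
  \<open>I\<close> that separates \<open>w\<close> from \<open>z\<close>; it vanishes at
  \<open>w\<close> and equals 1 at \<open>z\<close>.\<close>

lemma polyfun_Lagrange:
  assumes "finite Z" and "z \<in> Z"
    and sep: "\<And>w. w \<in> Z \<Longrightarrow> w \<noteq> z \<Longrightarrow> \<exists>i\<in>I. w i \<noteq> z i"
  shows "\<exists>f d. polyfun I d f \<and> f z = 1 \<and> (\<forall>w\<in>Z - {z}. f w = 0)"
proof -
  obtain j where j: "\<And>w. w \<in> Z - {z} \<Longrightarrow> j w \<in> I \<and> w (j w) \<noteq> z (j w)"
    using sep by (metis DiffE insertCI)
  define f where "f x = (\<Prod>w\<in>Z - {z}. inverse (z (j w) - w (j w)) * (x (j w) + - w (j w)))" for x
  have "polyfun I (\<Sum>w\<in>Z - {z}. 1) f"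
    unfolding f_def using j
    by (intro polyfun_prod polyfun_cmult polyfun.add polyfun.var polyfun.const) auto
  moreover have "f z = 1"
    unfolding f_def by (intro prod.neutral) (use j in fastforce)
  moreover have "f w = 0" if "w \<in> Z - {z}" for w
    unfolding f_def using that \<open>finite Z\<close> by (intro prod_zero) auto
  ultimately show ?thesis by blast
qed

text \<open>A weak Bezout bound: the equations reduce every polynomial on \<open>Z\<close> to one with all
  exponents below \<open>q\<close>, while every function on \<open>Z\<close> is a polynomial.\<close>

lemma card_solutions_le:
  assumes "finite I" "finite Z"
    and h: "\<And>i. i \<in> I \<Longrightarrow> polyfun I d (h i)" and "d < q"
    and eq: "\<And>i z. i \<in> I \<Longrightarrow> z \<in> Z \<Longrightarrow> z i ^ q = h i z"
    and sep: "\<And>w z. w \<in> Z \<Longrightarrow> z \<in> Z \<Longrightarrow> w \<noteq> z \<Longrightarrow> \<exists>i\<in>I. w i \<noteq> z i"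
  shows "card Z \<le> q ^ card I"
proof (rule ccontr)
  assume "\<not> card Z \<le> q ^ card I"
  then have "card (PiE I (\<lambda>_. {..<q})) < card Z"
    using \<open>finite I\<close> by (simp add: card_PiE)
  \<comment> \<open>There are only \<open>q ^ card I\<close> reduced exponent vectors, so some
    weights, not all zero, annihilate every reduced monomial.\<close>
  then obtain c where c: "\<exists>z\<in>Z. c z \<noteq> 0"
      and red: "\<forall>a\<in>PiE I (\<lambda>_. {..<q}). (\<Sum>z\<in>Z. c z * monomial I a z) = 0"
    using homogeneous_system_nontrivial[of "PiE I (\<lambda>_. {..<q})" Z "monomial I"] assms(1,2)
    by (auto simp: finite_PiE)
  \<comment> \<open>Induction on the total degree: trading a factor \<open>z i ^ q\<close> for
    \<open>h i z\<close> lowers it, since \<open>d < q\<close>.\<close>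
  have mon: "(\<Sum>z\<in>Z. c z * monomial I a z) = 0" for a
  proof (induction "sum a I" arbitrary: a rule: less_induct)
    case less
    show ?case
    proof (cases "\<forall>i\<in>I. a i < q")
      case True
      \<comment> \<open>Membership in \<open>PiE\<close> demands the default value outside
        \<open>I\<close>, which \<open>restrict\<close> supplies.\<close>
      then have "restrict a I \<in> PiE I (\<lambda>_. {..<q})" by auto
      moreover have "monomial I (restrict a I) = monomial I a"
        by (auto simp: monomial_def fun_eq_iff intro!: prod.cong)
      ultimately show ?thesis using red by fastforce
    next
      case False
      then obtain i where i: "i \<in> I" "q \<le> a i" by force
      define b where "b = a(i := a i - q)"
      have sb: "sum b I + q = sum a I"
        using i \<open>finite I\<close> by (simp add: b_def sum.remove[of I i])
      have m: "monomial I a z = monomial I b z * h i z" if "z \<in> Z" for z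
      proof -
        have "monomial I a z = (\<Prod>j\<in>I - {i}. z j ^ a j) * (z i ^ (a i - q) * z i ^ q)"
          using i \<open>finite I\<close> by (simp add: monomial_def prod.remove[of I i] flip: power_add)
        also have "\<dots> = monomial I b z * z i ^ q"
          using i \<open>finite I\<close> by (simp add: monomial_def b_def prod.remove[of I i])
        finally show ?thesis using eq[OF i(1) that] by simp
      qed
      have "polyfun I (sum b I + d) (\<lambda>z. monomial I b z * h i z)"
        by (intro polyfun.mult polyfun_monomial h i)
      then have "(\<Sum>z\<in>Z. c z * (monomial I b z * h i z)) = 0"
        using \<open>finite I\<close>
      proof (rule polyfun_annihilated)
        fix e assume "sum e I \<le> sum b I + d"
        then have "sum e I < sum a I" using sb \<open>d < q\<close> by linarith
        then show "(\<Sum>z\<in>Z. c z * monomial I e z) = 0" by (rule less)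
      qed
      then show ?thesis using m by simp
    qed
  qed
  \<comment> \<open>Testing the weights against the Lagrange polynomial of a point of nonzero weight
    isolates that weight.\<close>
  obtain z where z: "z \<in> Z" "c z \<noteq> 0" using c by blast
  then obtain f e where f: "polyfun I e f" "f z = 1" "\<And>w. w \<in> Z - {z} \<Longrightarrow> f w = 0"
    using polyfun_Lagrange[OF \<open>finite Z\<close> z(1), of I] sep by blast
  have "0 = (\<Sum>w\<in>Z. c w * f w)"
    using polyfun_annihilated[OF f(1) \<open>finite I\<close> mon] by simp
  also have "\<dots> = c z"
    using f z \<open>finite Z\<close> by (simp add: sum.remove[of Z z])
  finally show False using z by simp
qed

section \<open>Uniform margins and compact boxes\<close>

lemma uniform_positive_lower_bound:
  fixes a :: "'a \<Rightarrow> real"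
  assumes "finite U" "\<And>u. u \<in> U \<Longrightarrow> 0 < a u"
  shows "\<exists>e>0. \<forall>u\<in>U. e < a u"
  using assms
proof (induction U rule: finite_induct)
  case empty
  show ?case by (intro exI[of _ 1]) auto
next
  case (insert u U)
  then obtain e where "e > 0" "\<forall>u\<in>U. e < a u" by auto
  then show ?case using insert.prems[of u]
    by (intro exI[of _ "min e (a u / 2)"]) (auto simp: min_less_iff_disj)
qed

text \<open>Tychonoff: coordinates outside \<open>I\<close> range over the degenerate factor {0}, so
  the box is a product of compact sets even over an infinite index type.\<close>

lemma compact_coordinate_box:
  "compact {x :: 'i \<Rightarrow> real. (\<forall>i\<in>I. \<bar>x i\<bar> \<le> R) \<and> (\<forall>i. i \<notin> I \<longrightarrow> x i = 0)}"
proof -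
  have "compact (PiE UNIV (\<lambda>i::'i. if i \<in> I then {-R..R} else {0::real}))"
    unfolding compactin_euclidean_iff[symmetric] euclidean_product_topology[symmetric] compactin_PiE
    by auto
  also have "PiE UNIV (\<lambda>i::'i. if i \<in> I then {-R..R} else {0::real}) =
      {x. (\<forall>i\<in>I. \<bar>x i\<bar> \<le> R) \<and> (\<forall>i. i \<notin> I \<longrightarrow> x i = 0)}"
    by (auto simp: PiE_iff abs_le_iff split: if_splits) (smt (verit, best))+
  finally show ?thesis .
qed

section \<open>Sign patterns of polynomials\<close>

text \<open>On a cell of constant sign pattern, \<open>(\<Prod>j\<in>J. f j)\<^sup>2 - e * (\<Sum>i\<in>I. x i ^ (2 * D + 2))\<close>, with
  \<open>D\<close> the total degree, attains a positive maximum for small \<open>e\<close>. The maximum is a critical point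
  inside the cell.\<close>

lemma critical_point_in_sign_cell:
  fixes f :: "'j \<Rightarrow> ('i \<Rightarrow> real) \<Rightarrow> real"
  assumes "finite I" "finite J" and f: "\<And>j. j \<in> J \<Longrightarrow> polyfun I (d j) (f j)"
    and D: "D = sum d J" and "0 < e"
    and u0: "\<And>i. i \<notin> I \<Longrightarrow> u i = 0"
    and upos: "e * (\<Sum>i\<in>I. u i ^ (2 * D + 2)) < (\<Prod>j\<in>J. f j u)\<^sup>2"
    and F': "\<And>i x. i \<in> I \<Longrightarrow>
      ((\<lambda>t. (\<Prod>j\<in>J. f j (x(i := t)))\<^sup>2) has_real_derivative F' i x) (at (x i))"
  shows "\<exists>z. (\<forall>i. i \<notin> I \<longrightarrow> z i = 0) \<and> (\<forall>j\<in>J. 0 < f j z * f j u) \<and>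
    (\<forall>i\<in>I. F' i z = e * (real (2 * D + 2) * z i ^ (2 * D + 1)))"
proof -
  define P where "P x = (\<Prod>j\<in>J. f j x)\<^sup>2" for x
  define G where "G x = P x - e * (\<Sum>i\<in>I. x i ^ (2 * D + 2))" for x
  have polyP: "polyfun I (2 * D) P"
    unfolding P_def D using f by (intro polyfun_power polyfun_prod)
  obtain C where C: "\<And>m x. 1 \<le> m \<Longrightarrow> (\<forall>i\<in>I. \<bar>x i\<bar> \<le> m) \<Longrightarrow> \<bar>P x\<bar> \<le> C * m ^ (2 * D)"
    using polyfun_growth[OF polyP] by metis
  \<comment> \<open>The extra 1 makes the bound strict, so points with \<open>0 \<le> G x\<close>
    stay off the faces of the box and can be moved along a coordinate.\<close>
  define R where "R = max 1 (C / e) + 1"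
  have bounded: "\<bar>x i\<bar> < R" if "0 \<le> G x" "i \<in> I" for x i
  proof -
    \<comment> \<open>The sup norm, raised to at least 1. If it exceeds 1 it is attained at some
      coordinate, and comparing degree 2D + 2 with degree 2D bounds it.\<close>
    define m where "m = Max (insert 1 ((\<lambda>i. \<bar>x i\<bar>) ` I))"
    have m1: "1 \<le> m" and mx: "\<And>i. i \<in> I \<Longrightarrow> \<bar>x i\<bar> \<le> m"
      unfolding m_def using \<open>finite I\<close> by (auto intro: Max_ge)
    have "m \<le> max 1 (C / e)"
    proof (cases "m = 1")
      case False
      have "m \<in> insert 1 ((\<lambda>i. \<bar>x i\<bar>) ` I)"
        unfolding m_def using \<open>finite I\<close> by (intro Max_in) auto
      then obtain k where k: "k \<in> I" "m = \<bar>x k\<bar>" using False by auto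
      have "m ^ (2 * D + 2) = x k ^ (2 * D + 2)"
        by (simp add: k(2) power_even_abs)
      also have "\<dots> \<le> (\<Sum>i\<in>I. x i ^ (2 * D + 2))"
        using k(1) \<open>finite I\<close> by (intro member_le_sum zero_le_even_power) auto
      finally have "e * m ^ (2 * D + 2) \<le> e * (\<Sum>i\<in>I. x i ^ (2 * D + 2))"
        using \<open>0 < e\<close> by simp
      also have "\<dots> \<le> P x" using that(1) by (simp add: G_def)
      also have "\<dots> \<le> C * m ^ (2 * D)" using C[of m x] m1 mx by auto
      finally have "(e * m\<^sup>2) * m ^ (2 * D) \<le> C * m ^ (2 * D)"
        by (simp add: power_add power2_eq_square mult_ac)
      then have "e * m\<^sup>2 \<le> C" using m1 by (simp add: mult_le_cancel_right)
      then have "m\<^sup>2 \<le> C / e" using \<open>0 < e\<close> by (simp add: pos_le_divide_eq mult.commute)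
      moreover have "m \<le> m\<^sup>2" using m1 by (simp add: power2_eq_square)
      ultimately show ?thesis by linarith
    qed (simp)
    then show ?thesis using mx[OF that(2)] by (simp add: R_def)
  qed
  define B where "B = {x :: 'i \<Rightarrow> real. (\<forall>i\<in>I. \<bar>x i\<bar> \<le> R) \<and> (\<forall>i. i \<notin> I \<longrightarrow> x i = 0)}"
  \<comment> \<open>Weak inequalities make \<open>K\<close> closed. Where \<open>G\<close> is
    positive no factor vanishes, so the maximizer still satisfies the strict ones.\<close>
  define K where "K = B \<inter> (\<Inter>j\<in>J. {x. 0 \<le> f j x * f j u})"
  have cont: "continuous_on UNIV (f j)" if "j \<in> J" for j
    using polyfun_continuous[OF f[OF that]] .
  have "closed (\<Inter>j\<in>J. {x. 0 \<le> f j x * f j u})"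
    using cont by (intro closed_INT ballI closed_Collect_le continuous_intros) auto
  then have "compact K"
    unfolding K_def B_def by (intro compact_Int_closed compact_coordinate_box)
  moreover have "continuous_on K G"
  proof -
    have "polyfun I (2 * D + 2) (\<lambda>x. (\<Sum>i\<in>I. x i ^ (2 * D + 2)))"
      by (intro polyfun_sum) (use polyfun_power[OF polyfun.var, of _ I "2 * D + 2"] in simp)
    then have "continuous_on UNIV G"
      unfolding G_def using polyfun_continuous polyfun_continuous[OF polyP]
      by (intro continuous_intros) auto
    then show ?thesis by (rule continuous_on_subset) simp
  qed
  moreover have Gu: "0 < G u" using upos by (simp add: G_def P_def)
  moreover have "u \<in> K" using u0 bounded[of u] Gu by (force simp: K_def B_def)
  ultimately obtain z where z: "z \<in> K" "\<And>x. x \<in> K \<Longrightarrow> G x \<le> G z"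
    using continuous_attains_sup[of K G] by blast
  have Gz: "0 < G z" using z(2)[OF \<open>u \<in> K\<close>] Gu by simp
  have nonzero: "\<forall>j\<in>J. f j x \<noteq> 0" if "0 < G x" for x
  proof -
    have "0 \<le> e * (\<Sum>i\<in>I. x i ^ (2 * D + 2))"
      using \<open>0 < e\<close> by (intro mult_nonneg_nonneg sum_nonneg zero_le_even_power) auto
    then have "P x \<noteq> 0" using that by (simp add: G_def)
    then show ?thesis using \<open>finite J\<close> by (auto simp: P_def)
  qed
  have sign: "0 < f j z * f j u" if "j \<in> J" for j
    using nonzero[OF Gz] nonzero[OF Gu] z(1) that by (force simp: K_def less_le)
  have "F' i z = e * (real (2 * D + 2) * z i ^ (2 * D + 1))" if i: "i \<in> I" for i
  proof -
    define \<phi> where "\<phi> t = G (z(i := t))" for t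
    define r where "r = (\<Sum>k\<in>I - {i}. z k ^ (2 * D + 2))"
    have \<phi>_eq: "\<phi> = (\<lambda>t. P (z(i := t)) - e * (t ^ (2 * D + 2) + r))"
      using i \<open>finite I\<close> by (auto simp: \<phi>_def G_def r_def sum.remove[of I i])
    have "((\<lambda>t. t ^ (2 * D + 2) + r) has_real_derivative real (2 * D + 2) * z i ^ (2 * D + 1)) (at (z i))"
      using DERIV_add[OF DERIV_pow[of "2 * D + 2" "z i"] DERIV_const[of r]] by simp
    note pow = DERIV_cmult[OF this, of e]
    have "((\<lambda>t. P (z(i := t))) has_real_derivative F' i z) (at (z i))"
      unfolding P_def by (rule F'[OF i])
    from DERIV_diff[OF this pow] have der: "(\<phi> has_real_derivative F' i z - e * (real (2 * D + 2) * z i ^ (2 * D + 1))) (at (z i))"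
      unfolding \<phi>_eq .
    \<comment> \<open>Strict signs survive a small move of coordinate \<open>i\<close>, so the moved
      point remains in \<open>K\<close> and \<open>z i\<close> is a local maximum of
      \<open>\<phi>\<close>.\<close>
    have "\<forall>\<^sub>F t in nhds (z i). 0 < f j (z(i := t)) * f j u" if j: "j \<in> J" for j
    proof -
      obtain g where "((\<lambda>t. f j (z(i := t))) has_real_derivative g z) (at (z i))"
        using polyfun_partial_derivative[OF f[OF j], of i] by blast
      then have "((\<lambda>t. f j (z(i := t))) \<longlongrightarrow> f j (z(i := z i))) (nhds (z i))"
        using DERIV_isCont isCont_def tendsto_nhds_iff by blast
      then have "((\<lambda>t. f j (z(i := t)) * f j u) \<longlongrightarrow> f j z * f j u) (nhds (z i))"
        by (auto intro: tendsto_intros)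
      then show ?thesis using sign[OF j] by (rule order_tendstoD(1))
    qed
    then have "\<forall>\<^sub>F t in nhds (z i). \<forall>j\<in>J. 0 < f j (z(i := t)) * f j u"
      using \<open>finite J\<close> by (simp add: eventually_ball_finite)
    moreover have "\<forall>\<^sub>F t in nhds (z i). \<bar>t\<bar> < R"
    proof -
      have "((\<lambda>t. \<bar>t\<bar>) \<longlongrightarrow> \<bar>z i\<bar>) (nhds (z i))" by (intro tendsto_intros) (simp add: filterlim_ident)
      then show ?thesis using bounded[of z i] Gz i by (auto intro: order_tendstoD(2))
    qed
    ultimately have "\<forall>\<^sub>F t in nhds (z i). \<phi> t \<le> \<phi> (z i)"
    proof eventually_elim
      case (elim t)
      then have "z(i := t) \<in> K" using z(1) i by (auto simp: K_def B_def less_imp_le)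
      then show ?case using z(2) by (simp add: \<phi>_def)
    qed
    then obtain r where "0 < r" "\<forall>y. \<bar>z i - y\<bar> < r \<longrightarrow> \<phi> y \<le> \<phi> (z i)"
      by (auto simp: eventually_nhds_metric dist_real_def abs_minus_commute)
    then show ?thesis using DERIV_local_max[OF der] by fastforce
  qed
  then show ?thesis using sign z(1) by (intro exI[of _ z]) (auto simp: K_def B_def)
qed

text \<open>Each \<open>u\<close> represents its own cell, and critical points found in different
  cells are different. It remains to count solutions of equations setting
  \<open>x i ^ (2 * D + 1)\<close> equal to a polynomial of degree \<open>2 * D\<close>.\<close>

lemma card_strict_sign_patterns_le:
  fixes f :: "'j \<Rightarrow> ('i \<Rightarrow> real) \<Rightarrow> real"
  assumes "finite I" "finite J" "finite U" and f: "\<And>j. j \<in> J \<Longrightarrow> polyfun I (d j) (f j)"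
    and u0: "\<And>u i. u \<in> U \<Longrightarrow> i \<notin> I \<Longrightarrow> u i = 0"
    and nz: "\<And>u j. u \<in> U \<Longrightarrow> j \<in> J \<Longrightarrow> f j u \<noteq> 0"
    and inj: "inj_on (\<lambda>u. {j \<in> J. 0 < f j u}) U"
  shows "card U \<le> (2 * sum d J + 1) ^ card I"
proof -
  define D where "D = sum d J"
  define P where "P x = (\<Prod>j\<in>J. f j x)\<^sup>2" for x
  have polyP: "polyfun I (2 * D) P"
    unfolding P_def D_def using f by (intro polyfun_power polyfun_prod)
  obtain P' where P': "\<And>i. polyfun I (2 * D) (P' i)"
      "\<And>i x. ((\<lambda>t. P (x(i := t))) has_real_derivative P' i x) (at (x i))"
    using polyfun_partial_derivative[OF polyP] by metis
  define S where "S x = (\<Sum>i\<in>I. x i ^ (2 * D + 2))" for x :: "'i \<Rightarrow> real"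
  have S: "0 \<le> S x" for x unfolding S_def by (intro sum_nonneg zero_le_even_power) simp
  \<comment> \<open>One \<open>e\<close> has to serve all cells; the summand 1 keeps the denominator
    positive.\<close>
  have "0 < P u / (1 + S u)" if "u \<in> U" for u
    using nz[OF that] \<open>finite J\<close> S[of u] by (auto simp: P_def intro!: divide_pos_pos)
  then obtain e where e: "0 < e" "\<And>u. u \<in> U \<Longrightarrow> e < P u / (1 + S u)"
    using uniform_positive_lower_bound[OF \<open>finite U\<close>, of "\<lambda>u. P u / (1 + S u)"] by auto
  have "e * S u < P u" if "u \<in> U" for u
    using e(1) e(2)[OF that] S[of u] by (simp add: pos_less_divide_eq algebra_simps)
  then have "\<exists>z. (\<forall>i. i \<notin> I \<longrightarrow> z i = 0) \<and> (\<forall>j\<in>J. 0 < f j z * f j u) \<and>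
    (\<forall>i\<in>I. P' i z = e * (real (2 * D + 2) * z i ^ (2 * D + 1)))" if "u \<in> U" for u
    using that u0 f e(1) P'(2) \<open>finite I\<close> \<open>finite J\<close>
    by (intro critical_point_in_sign_cell[of I J d f D]) (auto simp: D_def S_def P_def simp del: fun_upd_apply)
  then obtain z where z: "\<And>u i. u \<in> U \<Longrightarrow> i \<notin> I \<Longrightarrow> z u i = 0"
      "\<And>u j. u \<in> U \<Longrightarrow> j \<in> J \<Longrightarrow> 0 < f j (z u) * f j u"
      "\<And>u i. u \<in> U \<Longrightarrow> i \<in> I \<Longrightarrow> P' i (z u) = e * (real (2 * D + 2) * z u i ^ (2 * D + 1))"
    by metis
  have "inj_on z U"
  proof (rule inj_onI)
    fix u v assume uv: "u \<in> U" "v \<in> U" "z u = z v"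
    have "0 < f j u \<longleftrightarrow> 0 < f j v" if "j \<in> J" for j
      using z(2)[OF uv(1) that] z(2)[OF uv(2) that] uv(3) by (auto simp: zero_less_mult_iff)
    then show "u = v" using inj_onD[OF inj _ uv(1,2)] by blast
  qed
  then have cardU: "card U = card (z ` U)" by (simp add: card_image)
  define c where "c = e * real (2 * D + 2)"
  have "c \<noteq> 0" using e(1) by (simp add: c_def)
  have crit: "P' i (z u) = c * z u i ^ (2 * D + 1)" if "u \<in> U" "i \<in> I" for u i
    using z(3)[OF that] by (simp only: c_def mult.assoc)
  note cardU
  also have "card (z ` U) \<le> (2 * D + 1) ^ card I"
  proof (rule card_solutions_le[where d = "2 * D"
        and h = "\<lambda>i x. inverse c * P' i x"])
    \<comment> \<open>The critical points vanish outside \<open>I\<close>, so different ones differ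
      inside \<open>I\<close>.\<close>
    show "\<exists>i\<in>I. w i \<noteq> y i" if "w \<in> z ` U" "y \<in> z ` U" "w \<noteq> y" for w y
      using that z(1) by (metis (no_types, lifting) ext image_iff)
    show "y i ^ (2 * D + 1) = inverse c * P' i y" if "i \<in> I" "y \<in> z ` U" for i y
      using that \<open>c \<noteq> 0\<close> crit by auto
  qed (use assms(1,3) P'(1) in \<open>auto intro: polyfun_cmult\<close>)
  finally show ?thesis by (simp add: D_def)
qed

text \<open>A positive shift below the modulus of every negative value that occurs turns weak signs
  into strict signs of nonvanishing polynomials, without raising degrees.\<close>

lemma card_sign_patterns_le:
  fixes f :: "'j \<Rightarrow> ('i \<Rightarrow> real) \<Rightarrow> real"
  assumes "finite I" "finite J" and f: "\<And>j. j \<in> J \<Longrightarrow> polyfun I (d j) (f j)"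
    and u0: "\<And>u i. u \<in> V \<Longrightarrow> i \<notin> I \<Longrightarrow> u i = 0"
  shows "card ((\<lambda>u. {j \<in> J. 0 \<le> f j u}) ` V) \<le> (2 * sum d J + 1) ^ card I"
proof -
  define pat where "pat u = {j \<in> J. 0 \<le> f j u}" for u
  \<comment> \<open>One representative per pattern; since \<open>U\<close> is finite, a uniform
    shift exists.\<close>
  obtain U where U: "U \<subseteq> V" "inj_on pat U" "pat ` V = pat ` U"
    using subset_image_inj[of "pat ` V" pat V] by auto
  have "finite (pat ` V)"
    by (rule finite_subset[of _ "Pow J"]) (auto simp: pat_def \<open>finite J\<close>)
  then have "finite U" using U finite_imageD by metis
  define Neg where "Neg = {(u, j) \<in> U \<times> J. f j u < 0}"
  have "finite Neg"
    using \<open>finite U\<close> \<open>finite J\<close> by (auto simp: Neg_def intro: finite_subset[of _ "U \<times> J"])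
  then have "\<exists>\<delta>>0. \<forall>(u, j)\<in>Neg. \<delta> < - f j u"
    using uniform_positive_lower_bound[of Neg "\<lambda>(u, j). - f j u"] by (auto simp: Neg_def)
  then obtain \<delta> where \<delta>: "0 < \<delta>" "\<And>u j. u \<in> U \<Longrightarrow> j \<in> J \<Longrightarrow> f j u < 0 \<Longrightarrow> \<delta> < - f j u"
    by (auto simp: Neg_def)
  have shift: "f j u + \<delta> \<noteq> 0 \<and> (0 < f j u + \<delta> \<longleftrightarrow> 0 \<le> f j u)" if "u \<in> U" "j \<in> J" for u j
    using \<delta>(2)[OF that] \<delta>(1) by (cases "f j u < 0") auto
  have "card U \<le> (2 * sum d J + 1) ^ card I"
  proof (rule card_strict_sign_patterns_le[where f = "\<lambda>j u. f j u + \<delta>"])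
    show "inj_on (\<lambda>u. {j \<in> J. 0 < f j u + \<delta>}) U"
      using U(2) shift by (auto simp: inj_on_def pat_def cong: conj_cong)
  qed (use assms U(1) \<open>finite U\<close> shift in \<open>auto intro!: polyfun.add polyfun.const\<close>)
  then show ?thesis using U by (simp add: card_image flip: pat_def)
qed

section \<open>Counting network outputs\<close>

text \<open>Weights and biases form one parameter vector, so that a network is a point at which
  polynomials can be evaluated; third index \<open>W\<close> marks the bias.\<close>

definition affine_map :: "nat \<Rightarrow> (nat \<times> nat \<times> nat \<Rightarrow> real) \<Rightarrow> nat \<Rightarrow> (nat \<Rightarrow> real) \<Rightarrow> nat \<Rightarrow> real" where
  "affine_map W \<theta> l v i = (\<Sum>j<W. \<theta> (l, i, j) * v j) + \<theta> (l, i, W)"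

primrec hidden :: "nat \<Rightarrow> (nat \<times> nat \<times> nat \<Rightarrow> real) \<Rightarrow> real \<Rightarrow> nat \<Rightarrow> nat \<Rightarrow> real" where
  "hidden W \<theta> x 0 = (\<lambda>i. if i = 0 then x else 0)"
| "hidden W \<theta> x (Suc l) = (\<lambda>i. max 0 (affine_map W \<theta> l (hidden W \<theta> x l) i))"

text \<open>All L + 1 affine maps get the same shape, \<open>W\<close> rows by \<open>W\<close>
  weights and a bias; row 0 of the last one gives the output.\<close>

definition params :: "nat \<Rightarrow> nat \<Rightarrow> (nat \<times> nat \<times> nat) set" where
  "params W L = {..L} \<times> {..<W} \<times> {..W}"

lemma finite_params: "finite (params W L)"
  by (simp add: params_def)

lemma card_params: "card (params W L) = Suc L * (W * Suc W)"
  by (simp add: params_def card_cartesian_product)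

text \<open>Padding with zero weights makes every hidden layer exactly \<open>W\<close> wide.\<close>

lemma NN_padded:
  assumes "g \<in> NN 1 1 W L" and "1 \<le> W"
  shows "\<exists>\<theta>. (\<forall>k. k \<notin> params W L \<longrightarrow> \<theta> k = 0) \<and>
    (\<forall>x. g (\<lambda>_. x) 0 = affine_map W \<theta> L (hidden W \<theta> x L) 0)"
proof -
  obtain A b Ns where Ns: "Ns 0 = 1" "Ns (Suc L) = 1" "\<forall>l\<in>{1..L}. Ns l \<le> W"
      and g: "g = nn_eval A b Ns L"
    using assms by (auto simp: NN_def)
  have width: "Ns l \<le> W" if "l \<le> L" for l
    using that Ns assms(2) by (cases l) auto
  \<comment> \<open>Rows beyond the true width of a layer and columns beyond that of the layer below
    vanish, so padding neurons have the value 0.\<close>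
  define \<theta> where "\<theta> = (\<lambda>(l, i, j). if (l, i, j) \<in> params W L \<and> i < Ns (Suc l)
    then if j = W then b l i else if j < Ns l then A l i j else 0 else 0)"
  have aff: "affine_map W \<theta> l v i =
      (if i < Ns (Suc l) then (\<Sum>j<Ns l. A l i j * w j) + b l i else 0)"
    if "l \<le> L" "i < W" "\<forall>j<W. v j = w j" for l i v w
  proof (cases "i < Ns (Suc l)")
    case True
    have "(\<Sum>j<W. \<theta> (l, i, j) * v j) = (\<Sum>j<Ns l. A l i j * w j)"
      using that True width[OF that(1)]
      by (intro sum.mono_neutral_cong_right) (auto simp: \<theta>_def params_def)
    moreover have "\<theta> (l, i, W) = b l i"
      using that True by (simp add: \<theta>_def params_def)
    ultimately show ?thesis using True by (simp add: affine_map_def)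
  qed (simp add: affine_map_def \<theta>_def)
  have hid: "\<forall>i<W. hidden W \<theta> x l i = layer_out A b Ns l (\<lambda>_. x) i" if "l \<le> L" for l x
    using that
  proof (induction l)
    case 0
    then show ?case using Ns by simp
  next
    case (Suc l)
    then show ?case using aff[of l _ "hidden W \<theta> x l" "layer_out A b Ns l (\<lambda>_. x)"] by simp
  qed
  have "g (\<lambda>_. x) 0 = affine_map W \<theta> L (hidden W \<theta> x L) 0" for x
    using aff[of L 0 "hidden W \<theta> x L" "layer_out A b Ns L (\<lambda>_. x)"] hid[of L x] Ns assms(2)
    by (simp add: g nn_eval_def)
  moreover have "\<forall>k. k \<notin> params W L \<longrightarrow> \<theta> k = 0"
    by (auto simp: \<theta>_def)
  ultimately show ?thesis by blast
qed

section \<open>Activation patterns, layer by layer\<close>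

definition activation :: "nat \<Rightarrow> nat \<Rightarrow> (nat \<times> nat \<times> nat \<Rightarrow> real) \<Rightarrow> nat \<Rightarrow> (nat \<times> nat \<times> nat) set" where
  "activation W N \<theta> l = {(k, n, i). k < l \<and> n \<in> {1..N} \<and> i < W \<and>
     0 \<le> affine_map W \<theta> k (hidden W \<theta> (real n) k) i}"

text \<open>The ReLU is replaced by a prescribed on/off pattern \<open>T\<close>, so that for fixed
  \<open>T\<close> the values are polynomial in the parameters.\<close>

primrec frozen_hidden :: "nat \<Rightarrow> (nat \<times> nat \<times> nat) set \<Rightarrow> nat \<Rightarrow> nat \<Rightarrow>
    (nat \<times> nat \<times> nat \<Rightarrow> real) \<Rightarrow> nat \<Rightarrow> real" where
  "frozen_hidden W T n 0 \<theta> = (\<lambda>i. if i = 0 then real n else 0)"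
| "frozen_hidden W T n (Suc l) \<theta> =
     (\<lambda>i. if (l, n, i) \<in> T then affine_map W \<theta> l (frozen_hidden W T n l \<theta>) i else 0)"

lemma affine_map_cong:
  "(\<And>j. j < W \<Longrightarrow> v j = w j) \<Longrightarrow> affine_map W \<theta> l v i = affine_map W \<theta> l w i"
  by (simp add: affine_map_def)

text \<open>Freezing a network at its own pattern changes nothing: active neurons pass their
  preactivation, the others give 0. A preactivation equal to 0 counts as active and yields 0 either
  way.\<close>

lemma frozen_hidden_activation:
  assumes "l \<le> m" "n \<in> {1..N}" "i < W"
  shows "frozen_hidden W (activation W N \<theta> m) n l \<theta> i = hidden W \<theta> (real n) l i"
  using assms(1,3)
proof (induction l arbitrary: i)
  case (Suc l)
  have "affine_map W \<theta> l (frozen_hidden W (activation W N \<theta> m) n l \<theta>) i =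
      affine_map W \<theta> l (hidden W \<theta> (real n) l) i"
    using Suc by (intro affine_map_cong) auto
  then show ?case using Suc.prems assms(2) by (auto simp: activation_def)
qed simp

text \<open>Each summand multiplies one parameter into a coordinate of the previous layer, so a
  layer costs one degree.\<close>

lemma polyfun_affine_map:
  assumes "\<And>j. j < W \<Longrightarrow> polyfun (params W L) d (\<lambda>\<theta>. v \<theta> j)" and "l \<le> L" "i < W"
  shows "polyfun (params W L) (Suc d) (\<lambda>\<theta>. affine_map W \<theta> l (v \<theta>) i)"
proof -
  have var: "polyfun (params W L) 1 (\<lambda>\<theta>. \<theta> (l, i, j))" if "j \<le> W" for j
    using that assms(2,3) by (intro polyfun.var) (auto simp: params_def)
  have "polyfun (params W L) (1 + d) (\<lambda>\<theta>. \<Sum>j<W. \<theta> (l, i, j) * v \<theta> j)"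
    using assms(1) var by (intro polyfun_sum polyfun.mult) auto
  moreover have "polyfun (params W L) (1 + d) (\<lambda>\<theta>. \<theta> (l, i, W))"
    by (rule polyfun.mono[OF var]) auto
  ultimately show ?thesis unfolding affine_map_def using polyfun.add by fastforce
qed

lemma polyfun_frozen_hidden:
  "l \<le> L \<Longrightarrow> i < W \<Longrightarrow> polyfun (params W L) l (\<lambda>\<theta>. frozen_hidden W T n l \<theta> i)"
proof (induction l arbitrary: i)
  case 0
  then show ?case by (simp add: polyfun.const)
next
  case (Suc l)
  then have "polyfun (params W L) (Suc l) (\<lambda>\<theta>. affine_map W \<theta> l (frozen_hidden W T n l \<theta>) i)"
    by (intro polyfun_affine_map) auto
  then show ?case by (cases "(l, n, i) \<in> T") (auto intro: polyfun.const)
qed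

lemma polyfun_frozen_affine_map:
  assumes "l \<le> L" "i < W"
  shows "polyfun (params W L) (Suc L) (\<lambda>\<theta>. affine_map W \<theta> l (frozen_hidden W T n l \<theta>) i)"
proof -
  have "polyfun (params W L) (Suc l) (\<lambda>\<theta>. affine_map W \<theta> l (frozen_hidden W T n l \<theta>) i)"
    using assms by (intro polyfun_affine_map polyfun_frozen_hidden) auto
  then show ?thesis using assms by (auto intro: polyfun.mono)
qed

text \<open>The polynomials may depend on the value \<open>T u\<close>. For each such value the
  family is fixed and the sign pattern bound applies; summing over the values gives the
  product.\<close>

lemma card_adaptive_sign_patterns_le:
  assumes "finite I" "finite J" "finite (T ` V)"
    and f: "\<And>t j. t \<in> T ` V \<Longrightarrow> j \<in> J \<Longrightarrow> polyfun I d (f t j)"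
    and V: "\<And>u i. u \<in> V \<Longrightarrow> i \<notin> I \<Longrightarrow> u i = 0"
  shows "card ((\<lambda>u. (T u, {j \<in> J. 0 \<le> f (T u) j u})) ` V)
    \<le> card (T ` V) * (2 * (card J * d) + 1) ^ card I"
proof -
  define Pat where "Pat t = (\<lambda>u. {j \<in> J. 0 \<le> f t j u}) ` V" for t
  have finPat: "finite (Pat t)" for t
    by (rule finite_subset[of _ "Pow J"]) (auto simp: Pat_def \<open>finite J\<close>)
  have "card (Pat t) \<le> (2 * (card J * d) + 1) ^ card I" if "t \<in> T ` V" for t
    unfolding Pat_def using card_sign_patterns_le[of I J "\<lambda>_. d" "f t" V] assms that by simp
  then have "card (SIGMA t:T ` V. Pat t) \<le> card (T ` V) * (2 * (card J * d) + 1) ^ card I"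
    using assms(3) finPat
      sum_bounded_above[of "T ` V" "\<lambda>t. card (Pat t)" "(2 * (card J * d) + 1) ^ card I"] by simp
  moreover have "card ((\<lambda>u. (T u, {j \<in> J. 0 \<le> f (T u) j u})) ` V) \<le> card (SIGMA t:T ` V. Pat t)"
    using assms(3) finPat by (intro card_mono finite_SigmaI) (auto simp: Pat_def)
  ultimately show ?thesis by linarith
qed

lemma finite_activation: "finite ((\<lambda>\<theta>. activation W N \<theta> l) ` V)"
  by (rule finite_subset[of _ "Pow ({..<l} \<times> {1..N} \<times> {..<W})"]) (auto simp: activation_def)

text \<open>Given the pattern below layer \<open>l\<close>, the \<open>N * W\<close> preactivations
  of layer \<open>l\<close> are polynomials. Using the degree bound L + 1 throughout makes every
  layer cost the same factor.\<close>

lemma card_activation_le: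
  assumes V: "\<And>\<theta> k. \<theta> \<in> V \<Longrightarrow> k \<notin> params W L \<Longrightarrow> \<theta> k = 0" and "l \<le> L"
  shows "card ((\<lambda>\<theta>. activation W N \<theta> l) ` V) \<le>
    ((2 * (N * W * Suc L) + 1) ^ card (params W L)) ^ l"
  using assms(2)
proof (induction l)
  case 0
  have "(\<lambda>\<theta>. activation W N \<theta> 0) ` V \<subseteq> {{}}" by (auto simp: activation_def)
  then have "card ((\<lambda>\<theta>. activation W N \<theta> 0) ` V) \<le> card {{} :: (nat \<times> nat \<times> nat) set}"
    by (intro card_mono) auto
  then show ?case by simp
next
  case (Suc l)
  define B where "B = (2 * (N * W * Suc L) + 1) ^ card (params W L)"
  define T where "T \<theta> = activation W N \<theta> l" for \<theta>
  define J where "J = {1..N} \<times> {..<W}"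
  define f where "f t = (\<lambda>(n, i) \<theta>. affine_map W \<theta> l (frozen_hidden W t n l \<theta>) i)" for t
  have f_eq: "f (T \<theta>) (n, i) \<theta> = affine_map W \<theta> l (hidden W \<theta> (real n) l) i" if "(n, i) \<in> J" for \<theta> n i
    using that unfolding f_def T_def J_def
    by (auto intro!: affine_map_cong frozen_hidden_activation)
  \<comment> \<open>The next pattern is determined by the previous one and the new signs.\<close>
  have step: "activation W N \<theta> (Suc l) =
      T \<theta> \<union> (\<lambda>(n, i). (l, n, i)) ` {j \<in> J. 0 \<le> f (T \<theta>) j \<theta>}" for \<theta>
  proof -
    have "{j \<in> J. 0 \<le> f (T \<theta>) j \<theta>} =
        {(n, i) \<in> J. 0 \<le> affine_map W \<theta> l (hidden W \<theta> (real n) l) i}"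
      using f_eq by auto
    then show ?thesis
      by (auto simp: T_def J_def activation_def less_Suc_eq image_iff)
  qed
  have "(\<lambda>\<theta>. activation W N \<theta> (Suc l)) ` V = (\<lambda>(t, s). t \<union> (\<lambda>(n, i). (l, n, i)) ` s) `
      ((\<lambda>\<theta>. (T \<theta>, {j \<in> J. 0 \<le> f (T \<theta>) j \<theta>})) ` V)"
    unfolding step image_image by simp
  moreover have fin: "finite (T ` V)" unfolding T_def by (rule finite_activation)
  moreover have "finite ((\<lambda>\<theta>. (T \<theta>, {j \<in> J. 0 \<le> f (T \<theta>) j \<theta>})) ` V)"
    by (rule finite_subset[of _ "T ` V \<times> Pow J"]) (use fin in \<open>auto simp: J_def\<close>)
  ultimately have "card ((\<lambda>\<theta>. activation W N \<theta> (Suc l)) ` V) \<le>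
      card ((\<lambda>\<theta>. (T \<theta>, {j \<in> J. 0 \<le> f (T \<theta>) j \<theta>})) ` V)"
    by (simp only: card_image_le)
  also have "\<dots> \<le> card (T ` V) * (2 * (card J * Suc L) + 1) ^ card (params W L)"
    using Suc.prems V fin finite_params
    by (intro card_adaptive_sign_patterns_le)
      (auto simp: J_def f_def intro!: polyfun_frozen_affine_map)
  also have "\<dots> = card (T ` V) * B"
    by (simp add: J_def B_def card_cartesian_product)
  also have "\<dots> \<le> B ^ l * B"
    using Suc by (intro mult_right_mono) (auto simp: B_def T_def)
  finally show ?case by (simp add: B_def mult.commute)
qed

text \<open>A target is recovered from the hidden activations together with the comparisons of the
  outputs with all integers in [-M, M]. The \<open>L\<close> hidden layers and these comparisons
  account for the factor \<open>Suc L\<close> on top of the parameter count.\<close>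

lemma interpolates_all_card_le:
  assumes "interpolates_all N M W L" "1 \<le> W"
    and X: "X \<subseteq> S_set N M" "\<And>x n. x \<in> X \<Longrightarrow> n \<notin> {1..N} \<Longrightarrow> x n = 0"
  shows "card X \<le> (2 * (N * W * (2 * M + 1) * Suc L) + 1) ^ (Suc L * (W * Suc W) * Suc L)"
proof -
  define E where "E = 2 * (N * W * (2 * M + 1) * Suc L) + 1"
  define P where "P = card (params W L)"
  have "\<exists>\<theta>. (\<forall>k. k \<notin> params W L \<longrightarrow> \<theta> k = 0) \<and>
      (\<forall>n\<in>{1..N}. affine_map W \<theta> L (hidden W \<theta> (real n) L) 0 = real_of_int (x n))"
    if "x \<in> X" for x
  proof -
    obtain g where "g \<in> NN 1 1 W L" "\<forall>n\<in>{1..N}. g (\<lambda>_. real n) 0 = real_of_int (x n)"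
      using assms(1) X(1) \<open>x \<in> X\<close> unfolding interpolates_all_def by blast
    then show ?thesis using NN_padded[OF _ assms(2), of g L] by metis
  qed
  then obtain \<theta> where \<theta>: "\<And>x k. x \<in> X \<Longrightarrow> k \<notin> params W L \<Longrightarrow> \<theta> x k = 0"
      "\<And>x n. x \<in> X \<Longrightarrow> n \<in> {1..N} \<Longrightarrow>
        affine_map W (\<theta> x) L (hidden W (\<theta> x) (real n) L) 0 = real_of_int (x n)"
    by metis
  define V where "V = \<theta> ` X"
  define T where "T \<theta> = activation W N \<theta> L" for \<theta>
  define J where "J = {1..N} \<times> {- int M..int M}"
  define f where "f t = (\<lambda>(n, k) \<theta>.
    affine_map W \<theta> L (frozen_hidden W t n L \<theta>) 0 + - real_of_int k)" for t
  define out where "out x = {j \<in> J. 0 \<le> f (T (\<theta> x)) j (\<theta> x)}" for x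
  have out_iff: "(n, k) \<in> out x \<longleftrightarrow> k \<le> x n" if "x \<in> X" "(n, k) \<in> J" for x n k
  proof -
    have "affine_map W (\<theta> x) L (frozen_hidden W (T (\<theta> x)) n L (\<theta> x)) 0 =
        affine_map W (\<theta> x) L (hidden W (\<theta> x) (real n) L) 0"
      using that(2) unfolding T_def J_def
      by (auto intro!: affine_map_cong frozen_hidden_activation)
    also have "\<dots> = real_of_int (x n)"
      using \<theta>(2)[OF that(1)] that(2) by (simp add: J_def)
    finally show ?thesis using that(2) by (simp add: out_def f_def)
  qed
  have range: "x n \<in> {- int M..int M}" if "x \<in> X" "n \<in> {1..N}" for x n
  proof -
    have "\<bar>x n\<bar> \<le> (\<Sum>n\<in>{1..N}. \<bar>x n\<bar>)" using that(2) by (intro member_le_sum) auto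
    also have "\<dots> \<le> int M" using X(1) that(1) by (auto simp: S_set_def)
    finally show ?thesis by auto
  qed
  have "inj_on out X"
  proof (rule inj_onI)
    fix x y assume xy: "x \<in> X" "y \<in> X" "out x = out y"
    \<comment> \<open>Both \<open>x n\<close> and \<open>y n\<close> are themselves thresholds, so
      equal comparisons give both inequalities.\<close>
    have "x n = y n" for n
    proof (cases "n \<in> {1..N}")
      case True
      then have "(n, x n) \<in> J" "(n, y n) \<in> J" using range xy by (auto simp: J_def)
      then show ?thesis using out_iff xy by (metis order_antisym order_refl)
    qed (use X(2)[OF xy(1)] X(2)[OF xy(2)] in simp)
    then show "x = y" by blast
  qed
  then have "card X = card (out ` X)" by (simp add: card_image)
  also have "out ` X = snd ` ((\<lambda>u. (T u, {j \<in> J. 0 \<le> f (T u) j u})) ` V)"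
    by (simp add: out_def V_def image_image)
  also have "card \<dots> \<le> card ((\<lambda>u. (T u, {j \<in> J. 0 \<le> f (T u) j u})) ` V)"
  proof (rule card_image_le, rule finite_subset)
    show "finite (T ` V \<times> Pow J)" using finite_activation[of W N L V] by (simp add: T_def J_def)
  qed auto
  also have "\<dots> \<le> card (T ` V) * (2 * (card J * Suc L) + 1) ^ P"
    unfolding P_def
  proof (rule card_adaptive_sign_patterns_le)
    fix t j assume "j \<in> J"
    obtain n k where "j = (n, k)" by fastforce
    then show "polyfun (params W L) (Suc L) (f t j)"
      unfolding f_def using assms(2)
      by (simp only: prod.case) (intro polyfun.add polyfun.const polyfun_frozen_affine_map, auto)
  qed (use finite_activation[of W N L V] \<theta>(1) finite_params in \<open>auto simp: T_def J_def V_def\<close>)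
  \<comment> \<open>\<open>E\<close> dominates the base for the hidden layers and the base for the
    output comparisons.\<close>
  also have "\<dots> \<le> (E ^ P) ^ L * E ^ P"
  proof (rule mult_mono)
    have "card (T ` V) \<le> ((2 * (N * W * Suc L) + 1) ^ P) ^ L"
      unfolding T_def P_def using \<theta>(1) by (intro card_activation_le) (auto simp: V_def)
    also have "\<dots> \<le> (E ^ P) ^ L"
      unfolding E_def by (intro power_mono) (auto simp: algebra_simps)
    finally show "card (T ` V) \<le> (E ^ P) ^ L" .
    have "card J = N * (2 * M + 1)" by (simp add: J_def card_cartesian_product nat_add_distrib nat_mult_distrib)
    then have "card J * Suc L * 1 \<le> N * (2 * M + 1) * Suc L * W"
      using assms(2) by (intro mult_le_mono) auto
    then have "2 * (card J * Suc L) + 1 \<le> E" by (simp add: E_def algebra_simps)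
    then show "(2 * (card J * Suc L) + 1) ^ P \<le> E ^ P" by (rule power_mono) simp
  qed auto
  also have "\<dots> = E ^ (P * Suc L)" by (simp add: power_add power_mult)
  finally show ?thesis by (simp add: E_def P_def card_params)
qed

section \<open>Entropy of the target set\<close>

text \<open>With Q = WL, the exponent is at most 6 Q^2 and the base at most b^2 Q^5;
  \<open>b\<close> stands for the larger of \<open>N\<close> and \<open>M\<close>.\<close>

lemma ln_card_bound:
  assumes "1 \<le> N" "N \<le> b" "M \<le> b" "2 \<le> W" "1 \<le> L"
  shows "ln (real ((2 * (N * W * (2 * M + 1) * Suc L) + 1) ^ (Suc L * (W * Suc W) * Suc L)))
    \<le> 6 * (real W * real L)\<^sup>2 * (2 * ln (real b) + 5 * ln (real W * real L))"
proof -
  define E where "E = 2 * (N * W * (2 * M + 1) * Suc L) + 1"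
  define e where "e = Suc L * (W * Suc W) * Suc L"
  define Q where "Q = real W * real L"
  have "2 * 1 \<le> Q" unfolding Q_def using assms by (intro mult_mono) auto
  then have Q: "2 \<le> Q" by simp
  have "2 * e \<le> 12 * (W * L)\<^sup>2"
  proof -
    have L: "Suc L \<le> 2 * L" and W: "2 * Suc W \<le> 3 * W" using assms by auto
    have "Suc L * Suc L * (W * (2 * Suc W)) \<le> (2 * L) * (2 * L) * (W * (3 * W))"
      by (rule mult_le_mono[OF mult_le_mono[OF L L] mult_le_mono[OF le_refl W]])
    then show ?thesis by (simp add: e_def power2_eq_square algebra_simps)
  qed
  then have "real (2 * e) \<le> real (12 * (W * L)\<^sup>2)" by (simp only: of_nat_le_iff)
  then have e: "real e \<le> 6 * Q\<^sup>2" by (simp add: Q_def)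
  have "N * W * (2 * M + 1) * Suc L \<le> b * W * (3 * b) * (2 * L)"
    using assms by (intro mult_mono) auto
  also have "\<dots> = 6 * (b\<^sup>2 * (W * L))" by (simp add: power2_eq_square)
  finally have "E \<le> 12 * (b\<^sup>2 * (W * L)) + 1"
    unfolding E_def by simp
  moreover have "1 \<le> b\<^sup>2 * (W * L)" using assms by simp
  ultimately have "E \<le> 13 * (b\<^sup>2 * (W * L))" by linarith
  then have "real E \<le> real (13 * (b\<^sup>2 * (W * L)))" by (simp only: of_nat_le_iff)
  then have "real E \<le> 13 * ((real b)\<^sup>2 * Q)" by (simp add: Q_def)
  \<comment> \<open>The constant is absorbed by 13 \<le> 2^4 \<le> Q^4.\<close>
  also have "\<dots> \<le> Q ^ 4 * ((real b)\<^sup>2 * Q)"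
    using power_mono[OF Q, of 4] Q by (intro mult_right_mono) auto
  also have "\<dots> = (real b)\<^sup>2 * Q ^ 5" by (simp add: eval_nat_numeral)
  finally have "real E \<le> (real b)\<^sup>2 * Q ^ 5" .
  moreover have E: "1 \<le> real E" by (simp add: E_def)
  ultimately have "ln (real E) \<le> ln ((real b)\<^sup>2 * Q ^ 5)"
    by (subst ln_le_cancel_iff) auto
  also have "\<dots> = 2 * ln (real b) + 5 * ln Q"
    using assms Q by (simp add: ln_mult ln_realpow)
  finally have "real e * ln (real E) \<le> 6 * Q\<^sup>2 * (2 * ln (real b) + 5 * ln Q)"
    using e E by (intro mult_mono) auto
  then have "ln (real (E ^ e)) \<le> 6 * Q\<^sup>2 * (2 * ln (real b) + 5 * ln Q)"
    using E by (simp add: ln_realpow)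
  then show ?thesis unfolding E_def e_def Q_def .
qed

lemma half_le_ln2: "1 / 2 \<le> ln (2 :: real)"
  using ln_le_minus_one[of "1 / 2"] by (simp add: ln_div)

text \<open>The power of 2 pays for the summand 1, at cost 2 \<open>ln x\<close> because ln 2 is at
  least 1/2; the power of \<open>r\<close> pays for \<open>ln r\<close>.\<close>

lemma entropy_le_of_power_le:
  assumes "2 ^ k \<le> x" "r ^ k \<le> x" "1 \<le> r"
  shows "real k * (1 + ln r) \<le> 3 * ln x"
proof -
  have x: "0 < x" using assms(1) by (smt (verit) zero_less_power)
  have "real k * ln 2 \<le> ln x"
    using assms(1) x by (simp flip: ln_realpow)
  moreover have "real k * (1 / 2) \<le> real k * ln 2"
    using half_le_ln2 by (intro mult_left_mono) auto
  moreover have "real k * ln r \<le> ln x"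
    using assms x by (simp flip: ln_realpow)
  ultimately show ?thesis by (simp add: algebra_simps)
qed

text \<open>Since \<open>ln\<close> of the bound on \<open>H\<close> is sublinear in \<open>y\<close>, the hypothesis \<open>y \<le> p * (c + ln k)\<close>
  can be solved for \<open>y\<close>.\<close>

lemma absorb_logarithm:
  fixes p c :: real
  assumes "1 \<le> p" "0 \<le> c"
  shows "\<exists>C>0. \<forall>k y Q H. 1 \<le> k \<longrightarrow> 2 \<le> Q \<longrightarrow> 0 \<le> y \<longrightarrow> k \<le> H \<longrightarrow> y \<le> p * (c + ln k) \<longrightarrow>
    H \<le> 18 * Q\<^sup>2 * (2 * y + 5 * ln Q) \<longrightarrow> C * H \<le> Q\<^sup>2 * ln Q"
proof -
  \<comment> \<open>\<open>c1\<close> and \<open>K\<close> are read off from solving the linear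
    inequality for \<open>y\<close> below.\<close>
  define c1 where "c1 = 2 * p * (c + ln 18 + ln (4 * p))"
  define K where "K = 2 * c1 + 4 * p + 5 / 2"
  have c1: "0 \<le> c1" unfolding c1_def using assms by simp
  then have K: "0 < K" using assms by (simp add: K_def)
  have "1 / (18 * (2 * K + 5)) * H \<le> Q\<^sup>2 * ln Q"
    if k: "1 \<le> k" and Q: "2 \<le> Q" and y: "0 \<le> y" and kH: "k \<le> H" and yk: "y \<le> p * (c + ln k)"
      and H: "H \<le> 18 * Q\<^sup>2 * (2 * y + 5 * ln Q)" for k y Q H :: real
  proof -
    have lnQ: "1 \<le> 2 * ln Q"
      using Q half_le_ln2 ln_le_cancel_iff[of 2 Q] by linarith
    define z where "z = 2 * y + 5 * ln Q"
    have z: "0 < z" using y lnQ by (simp add: z_def)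
    have "ln k \<le> ln (18 * Q\<^sup>2 * z)" using k kH H by (simp add: z_def)
    also have "\<dots> = ln 18 + 2 * ln Q + ln z" using Q z by (simp add: ln_mult ln_realpow)
    finally have lnk: "ln k \<le> ln 18 + 2 * ln Q + ln z" .
    \<comment> \<open>Splitting off \<open>4 * p\<close> leaves the term z/4, which contains only
      y/2 and can be moved to the left.\<close>
    have "ln z = ln (4 * p) + ln (z / (4 * p))"
      using z assms by (simp add: ln_div)
    also have "ln (z / (4 * p)) \<le> z / (4 * p)"
      using ln_le_minus_one[of "z / (4 * p)"] z assms by simp
    finally have "p * (c + ln k) \<le> p * (c + (ln 18 + 2 * ln Q + (ln (4 * p) + z / (4 * p))))"
      using lnk assms by (intro mult_left_mono) auto
    also have "\<dots> = c1 / 2 + 2 * p * ln Q + z / 4"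
      using assms by (simp add: c1_def field_simps)
    finally have "y \<le> c1 / 2 + 2 * p * ln Q + z / 4" using yk by (rule order_trans[rotated])
    then have "y \<le> c1 + 4 * p * ln Q + 5 / 2 * ln Q" by (simp add: z_def field_simps)
    also have "\<dots> \<le> c1 * (2 * ln Q) + 4 * p * ln Q + 5 / 2 * ln Q"
      using mult_left_mono[OF lnQ c1] by simp
    also have "\<dots> = K * ln Q" by (simp add: K_def algebra_simps)
    finally have "2 * y + 5 * ln Q \<le> (2 * K + 5) * ln Q" by (simp add: algebra_simps)
    then have "18 * Q\<^sup>2 * (2 * y + 5 * ln Q) \<le> 18 * Q\<^sup>2 * ((2 * K + 5) * ln Q)"
      using Q by (intro mult_left_mono) auto
    then have "H \<le> (18 * (2 * K + 5)) * (Q\<^sup>2 * ln Q)" using H by (simp add: mult_ac)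
    then show ?thesis using K by (simp add: field_simps)
  qed
  then show ?thesis using K by (intro exI[of _ "1 / (18 * (2 * K + 5))"]) auto
qed

section \<open>Large families of integer targets\<close>

lemma S_set_subset_family:
  assumes "\<And>s. s \<in> \<S> \<Longrightarrow> s \<subseteq> {1..N} \<and> card s \<le> M"
  shows "\<exists>X \<subseteq> S_set N M. (\<forall>x\<in>X. \<forall>n. n \<notin> {1..N} \<longrightarrow> x n = 0) \<and> card X = card \<S>"
proof -
  \<comment> \<open>The l1 norm of an indicator vector is the size of the set.\<close>
  define v :: "nat set \<Rightarrow> nat \<Rightarrow> int" where "v s n = (if n \<in> s then 1 else 0)" for s n
  have "inj v"
  proof (rule injI)
    fix s t assume "v s = v t"
    then have "v s n = v t n" for n by simp
    then have "n \<in> s \<longleftrightarrow> n \<in> t" for n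
      unfolding v_def by (metis zero_neq_one)
    then show "s = t" by blast
  qed
  then have "card (v ` \<S>) = card \<S>" by (metis card_image inj_on_subset subset_UNIV)
  moreover have "v s \<in> S_set N M" if "s \<in> \<S>" for s
  proof -
    have "(\<Sum>n\<in>{1..N}. \<bar>v s n\<bar>) = (\<Sum>n\<in>s. 1)"
      using assms[OF that] by (intro sum.mono_neutral_cong_right) (auto simp: v_def)
    then show ?thesis using assms[OF that] by (simp add: S_set_def)
  qed
  moreover have "v s n = 0" if "s \<in> \<S>" "n \<notin> {1..N}" for s n
    using assms[OF that(1)] that(2) by (auto simp: v_def)
  ultimately show ?thesis by (intro exI[of _ "v ` \<S>"]) auto
qed

text \<open>A separate budget \<open>M div N\<close> for each coordinate keeps the total within
  \<open>M\<close> and makes the coordinates independent.\<close>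

lemma S_set_box:
  "\<exists>X \<subseteq> S_set N M. (\<forall>x\<in>X. \<forall>n. n \<notin> {1..N} \<longrightarrow> x n = 0) \<and> card X = (M div N + 1) ^ N"
proof -
  define F where "F = PiE {1..N} (\<lambda>_. {..M div N})"
  define v :: "(nat \<Rightarrow> nat) \<Rightarrow> nat \<Rightarrow> int" where
    "v f n = (if n \<in> {1..N} then int (f n) else 0)" for f n
  have "inj_on v F"
  proof (rule inj_onI)
    fix f g assume fg: "f \<in> F" "g \<in> F" "v f = v g"
    have "f n = g n" if "n \<in> {1..N}" for n
      using fun_cong[OF fg(3), of n] that by (simp add: v_def)
    then show "f = g" using fg(1,2) unfolding F_def by (intro PiE_ext) auto
  qed
  then have "card (v ` F) = (M div N + 1) ^ N"
    by (simp add: card_image F_def card_PiE)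
  moreover have "v f \<in> S_set N M" if "f \<in> F" for f
  proof -
    have "(\<Sum>n\<in>{1..N}. \<bar>v f n\<bar>) \<le> (\<Sum>n\<in>{1..N}. int (M div N))"
      using that by (intro sum_mono) (auto simp: v_def F_def)
    also have "\<dots> \<le> int M" by (simp flip: of_nat_mult)
    finally show ?thesis by (simp add: S_set_def)
  qed
  ultimately show ?thesis by (intro exI[of _ "v ` F"]) (auto simp: v_def)
qed

section \<open>The two lower bounds\<close>

lemma interpolates_all_entropy_le:
  assumes "interpolates_all N M W L" "2 \<le> W" "1 \<le> L" "1 \<le> N" "N \<le> b" "M \<le> b" "1 \<le> r"
    and two: "\<exists>X \<subseteq> S_set N M. (\<forall>x\<in>X. \<forall>n. n \<notin> {1..N} \<longrightarrow> x n = 0) \<and> 2 ^ k \<le> card X"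
    and r: "\<exists>X \<subseteq> S_set N M. (\<forall>x\<in>X. \<forall>n. n \<notin> {1..N} \<longrightarrow> x n = 0) \<and> r ^ k \<le> real (card X)"
  shows "real k * (1 + ln r) \<le> 18 * (real W * real L)\<^sup>2 * (2 * ln (real b) + 5 * ln (real W * real L))"
proof -
  \<comment> \<open>The same \<open>B\<close> bounds every family of targets, so the two powers may
    come from different families.\<close>
  define B where "B = (2 * (N * W * (2 * M + 1) * Suc L) + 1) ^ (Suc L * (W * Suc W) * Suc L)"
  have bound: "card X \<le> B" if "X \<subseteq> S_set N M" "\<forall>x\<in>X. \<forall>n. n \<notin> {1..N} \<longrightarrow> x n = 0" for X
    unfolding B_def using that assms(2) by (intro interpolates_all_card_le[OF assms(1)]) auto
  have "2 ^ k \<le> B" using two bound order_trans by metis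
  then have "2 ^ k \<le> real B" by (metis of_nat_le_iff of_nat_numeral of_nat_power)
  moreover have "r ^ k \<le> real B" using r bound by (meson of_nat_le_iff order_trans)
  ultimately have "real k * (1 + ln r) \<le> 3 * ln (real B)"
    using \<open>1 \<le> r\<close> by (rule entropy_le_of_power_le)
  also have "\<dots> \<le> 3 * (6 * (real W * real L)\<^sup>2 * (2 * ln (real b) + 5 * ln (real W * real L)))"
    unfolding B_def using assms by (intro mult_left_mono ln_card_bound) auto
  also have "\<dots> = 18 * (real W * real L)\<^sup>2 * (2 * ln (real b) + 5 * ln (real W * real L))"
    by simp
  finally show ?thesis .
qed

text \<open>Subsets of \<open>{1..M}\<close> give the power of 2, which matters when N/M is near 1;
  subsets of \<open>{1..N}\<close> of size \<open>M\<close> give the power of N/M through the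
  binomial coefficient.\<close>

lemma interpolates_all_sparse:
  assumes "interpolates_all N M W L" "2 \<le> W" "1 \<le> L" "1 \<le> M" "M \<le> N"
  shows "real M * (1 + ln (real N / real M)) \<le>
    18 * (real W * real L)\<^sup>2 * (2 * ln (real N) + 5 * ln (real W * real L))"
proof (rule interpolates_all_entropy_le)
  show "\<exists>X \<subseteq> S_set N M. (\<forall>x\<in>X. \<forall>n. n \<notin> {1..N} \<longrightarrow> x n = 0) \<and> 2 ^ M \<le> card X"
  proof -
    have "s \<subseteq> {1..N} \<and> card s \<le> M" if "s \<in> Pow {1..M}" for s
      using that assms(5) card_mono[of "{1..M}" s] by auto
    then obtain X where "X \<subseteq> S_set N M" "\<forall>x\<in>X. \<forall>n. n \<notin> {1..N} \<longrightarrow> x n = 0"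
        "card X = card (Pow {1..M})"
      using S_set_subset_family[of "Pow {1..M}" N M] by blast
    then show ?thesis by (intro exI[of _ X]) (simp add: card_Pow)
  qed
  have "(real N / real M) ^ M \<le> real (N choose M)"
    using assms(5) by (rule binomial_ge_n_over_k_pow_k)
  moreover obtain X where "X \<subseteq> S_set N M" "\<forall>x\<in>X. \<forall>n. n \<notin> {1..N} \<longrightarrow> x n = 0"
      "card X = card {s. s \<subseteq> {1..N} \<and> card s = M}"
    using S_set_subset_family[of "{s. s \<subseteq> {1..N} \<and> card s = M}" N M] by blast
  ultimately show "\<exists>X \<subseteq> S_set N M. (\<forall>x\<in>X. \<forall>n. n \<notin> {1..N} \<longrightarrow> x n = 0) \<and>
      (real N / real M) ^ M \<le> real (card X)"
    using n_subsets[of "{1..N}" M] by (intro exI[of _ X]) simp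
qed (use assms in auto)

text \<open>One box family serves twice: \<open>M div N + 1\<close> is at least 2 and at least
  M/N.\<close>

lemma interpolates_all_dense:
  assumes "interpolates_all N M W L" "2 \<le> W" "1 \<le> L" "1 \<le> N" "N \<le> M"
  shows "real N * (1 + ln (real M / real N)) \<le>
    18 * (real W * real L)\<^sup>2 * (2 * ln (real M) + 5 * ln (real W * real L))"
proof (rule interpolates_all_entropy_le)
  obtain X where X: "X \<subseteq> S_set N M" "\<forall>x\<in>X. \<forall>n. n \<notin> {1..N} \<longrightarrow> x n = 0"
      "card X = (M div N + 1) ^ N"
    using S_set_box by metis
  have "1 \<le> M div N" using assms(4,5) by (simp add: Suc_le_eq div_greater_zero_iff)
  then have "2 ^ N \<le> card X" unfolding X(3) by (intro power_mono) auto
  then show "\<exists>X \<subseteq> S_set N M. (\<forall>x\<in>X. \<forall>n. n \<notin> {1..N} \<longrightarrow> x n = 0) \<and> 2 ^ N \<le> card X"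
    using X by blast
  have "M \<le> (M div N + 1) * N"
    using dividend_less_div_times[of N M] assms(4) by simp
  then have "real M \<le> real (M div N + 1) * real N"
    by (metis of_nat_le_iff of_nat_mult)
  then have "real M / real N \<le> real (M div N + 1)"
    using assms(4) by (simp add: pos_divide_le_eq)
  then have "(real M / real N) ^ N \<le> real (card X)"
    unfolding X(3) of_nat_power by (intro power_mono) auto
  then show "\<exists>X \<subseteq> S_set N M. (\<forall>x\<in>X. \<forall>n. n \<notin> {1..N} \<longrightarrow> x n = 0) \<and>
      (real M / real N) ^ N \<le> real (card X)"
    using X by blast
qed (use assms in auto)

theorem mainTheorem8:
  fixes p C0 :: real
  assumes "p \<ge> 1" and "C0 > 0"
  shows "(\<exists>C>0. \<forall>N M W L :: nat.
            W \<ge> 2 \<and> L \<ge> 1 \<and> interpolates_all N M W L \<and>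
            real M \<le> real N \<and> C0 * real N powr (1 / p) \<le> real M \<longrightarrow>
            real W ^ 2 * real L ^ 2 * ln (real W * real L)
              \<ge> C * real M * (1 + ln (real N / real M)))
       \<and> (\<exists>C>0. \<forall>N M W L :: nat.
            W \<ge> 2 \<and> L \<ge> 1 \<and> interpolates_all N M W L \<and>
            real N \<le> real M \<and> real M \<le> C0 * real N powr p \<longrightarrow>
            real W ^ 2 * real L ^ 2 * ln (real W * real L)
              \<ge> C * real N * (1 + ln (real M / real N)))"
proof -
  \<comment> \<open>The same constant serves both parts: \<open>k\<close> will be the smaller of
    \<open>N\<close> and \<open>M\<close>, and \<open>y\<close> the logarithm of the larger.\<close>
  obtain C where C: "0 < C" "\<And>k y Q H. 1 \<le> k \<Longrightarrow> 2 \<le> Q \<Longrightarrow> 0 \<le> y \<Longrightarrow> k \<le> H \<Longrightarrow>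
      y \<le> p * (\<bar>ln C0\<bar> + ln k) \<Longrightarrow> H \<le> 18 * Q\<^sup>2 * (2 * y + 5 * ln Q) \<Longrightarrow> C * H \<le> Q\<^sup>2 * ln Q"
    using absorb_logarithm[OF assms(1), of "\<bar>ln C0\<bar>"] by auto
  have Q: "2 \<le> real W * real L" if "2 \<le> W" "1 \<le> L" for W L :: nat
    using mult_mono[of 2 "real W" 1 "real L"] that by simp
  have sparse: "C * real M * (1 + ln (real N / real M)) \<le>
      real W ^ 2 * real L ^ 2 * ln (real W * real L)"
    if "2 \<le> W" "1 \<le> L" "interpolates_all N M W L" "M \<le> N" "C0 * real N powr (1 / p) \<le> real M"
    for N M W L :: nat
  \<comment> \<open>For \<open>M = 0\<close> the left side is 0 and the right side
    nonnegative.\<close>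
  proof (cases "M = 0")
    case True
    then show ?thesis using Q[OF that(1,2)] by simp
  next
    case False
    have "ln (C0 * real N powr (1 / p)) \<le> ln (real M)"
      using that(4,5) False assms by (subst ln_le_cancel_iff) auto
    then have "ln C0 + 1 / p * ln (real N) \<le> ln (real M)"
      using that(4) False assms by (simp add: ln_mult ln_powr)
    then have "p * (1 / p * ln (real N)) \<le> p * (\<bar>ln C0\<bar> + ln (real M))"
      using assms by (intro mult_left_mono) auto
    then have "ln (real N) \<le> p * (\<bar>ln C0\<bar> + ln (real M))" using assms by simp
    then have "C * (real M * (1 + ln (real N / real M))) \<le> (real W * real L)\<^sup>2 * ln (real W * real L)"
      using interpolates_all_sparse[OF that(3,1,2)] that(4) False Q[OF that(1,2)]
      by (intro C(2)[of "real M" _ "ln (real N)"]) auto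
    then show ?thesis by (simp add: power_mult_distrib mult.assoc)
  qed
  have dense: "C * real N * (1 + ln (real M / real N)) \<le>
      real W ^ 2 * real L ^ 2 * ln (real W * real L)"
    if "2 \<le> W" "1 \<le> L" "interpolates_all N M W L" "N \<le> M" "real M \<le> C0 * real N powr p"
    for N M W L :: nat
  proof (cases "N = 0")
    case True
    then show ?thesis using Q[OF that(1,2)] by simp
  next
    case False
    have "ln (real M) \<le> ln (C0 * real N powr p)"
      using that(4,5) False assms by (subst ln_le_cancel_iff) auto
    then have "ln (real M) \<le> ln C0 + p * ln (real N)"
      using False assms by (simp add: ln_mult ln_powr)
    \<comment> \<open>Since \<open>p\<close> is at least 1, this brings the bound into the form
      \<open>p * (c + ln k)\<close> used in both parts.\<close>
    moreover have "1 * \<bar>ln C0\<bar> \<le> p * \<bar>ln C0\<bar>" using assms by (intro mult_right_mono) auto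
    ultimately have "ln (real M) \<le> p * (\<bar>ln C0\<bar> + ln (real N))" by (simp add: distrib_left)
    then have "C * (real N * (1 + ln (real M / real N))) \<le> (real W * real L)\<^sup>2 * ln (real W * real L)"
      using interpolates_all_dense[OF that(3,1,2)] that(4) False Q[OF that(1,2)]
      by (intro C(2)[of "real N" _ "ln (real M)"]) auto
    then show ?thesis by (simp add: power_mult_distrib mult.assoc)
  qed
  show ?thesis
    by (intro conjI exI[of _ C] C(1) allI impI; elim conjE)
      (rule sparse dense; simp only: of_nat_le_iff)+
qed

end
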